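(* Let $K\ge 3$ be a fixed integer and consider the equation $$(M+N)^2=KMN+1. \qquad ( * )$$ The following three maps are involutions on the set of integral solutions $(M,N)\in\mathbb{Z}^2$ of $( * )$: $$\iota_0:(M,N)\mapsto (N,M),\qquad \iota_1:(M,N)\mapsto (M,(K-2)M-N),\qquad \iota_2:(M,N)\mapsto ((K-2)N-M,N).$$ They satisfy the relation $\iota_2=\iota_0\iota_1\iota_0$. All integral non-negative solutions of $( * )$ can be obtained by starting with $(0,1)$ and applying $\iota_0$ and $\iota_1$ alternately: $$(0,1)\overset{\iota_0}{\longmapsto}(1,0)\overset{\iota_1}{\longmapsto}(1,K-2)\overset{\iota_0}{\longmapsto}(K-2,1)\overset{\iota_1}{\longmapsto}(K-2,(K-2)^2-1)\overset{\iota_0}{\longmapsto}\cdots .$$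
   Context: A non-negative solution means a solution with $M\ge 0$ and $N\ge 0$. *)

theory Defs
  imports Main
begin

definition solutions :: "int \<Rightarrow> (int \<times> int) set" where
  "solutions K = {(M, N). (M + N)^2 = K * M * N + 1}"

definition nonneg_solutions :: "int \<Rightarrow> (int \<times> int) set" where
  "nonneg_solutions K = {(M, N) \<in> solutions K. M \<ge> 0 \<and> N \<ge> 0}"

fun iota0 :: "int \<times> int \<Rightarrow> int \<times> int" where
  "iota0 (M, N) = (N, M)"

fun iota1 :: "int \<Rightarrow> int \<times> int \<Rightarrow> int \<times> int" where
  "iota1 K (M, N) = (M, (K - 2) * M - N)"

fun iota2 :: "int \<Rightarrow> int \<times> int \<Rightarrow> int \<times> int" where
  "iota2 K (M, N) = ((K - 2) * N - M, N)"

definition involution_on :: "'a set \<Rightarrow> ('a \<Rightarrow> 'a) \<Rightarrow> bool" where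
  "involution_on S f \<longleftrightarrow> (\<forall>x\<in>S. f x \<in> S \<and> f (f x) = x)"

text \<open>The alternating sequence: \<open>iota0\<close> is applied first, then \<open>iota1\<close>, and so on.
  For \<open>K = 3\<close> it eventually leaves the non-negative quadrant:
  (0,1), (1,0), (1,1), (1,1), (1,0), (0,1), (0,-1), ...\<close>
primrec orbit :: "int \<Rightarrow> nat \<Rightarrow> int \<times> int" where
  "orbit K 0 = (0, 1)"
| "orbit K (Suc n) = (if even n then iota0 (orbit K n) else iota1 K (orbit K n))"

end

(* Vieta jumping.  For a solution with 0 < M <= N, put N' = (K-2)M - N; since N and N' are the roots
   of a monic quadratic with constant term M^2 - 1, we have N N' = M^2 - 1, hence 0 <= N' < M.
   So (N', M) is a smaller solution, and (M, N) arises from it by iota0 followed by iota1.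
   The descent stops at M = 0, where N = 1. *)
theory Submission
  imports Defs
begin

text \<open>Moving \<open>2 * M * N\<close> to the right yields a form symmetric in \<open>M\<close>
  and \<open>N\<close> and monic quadratic in each, so root swaps reduce to ring arithmetic.\<close>

lemma mem_solutions_iff:
  "(M, N) \<in> solutions K \<longleftrightarrow> M * M + N * N = (K - 2) * M * N + 1"
  by (auto simp: solutions_def power2_eq_square algebra_simps)

lemma involution_on_iota0: "involution_on (solutions K) iota0"
  by (auto simp: involution_on_def mem_solutions_iff algebra_simps)

lemma involution_on_iota1: "involution_on (solutions K) (iota1 K)"
  by (auto simp: involution_on_def mem_solutions_iff algebra_simps)

lemma iota2_eq_conj: "iota2 K = iota0 \<circ> iota1 K \<circ> iota0"
  by auto

lemma involution_on_iota2: "involution_on (solutions K) (iota2 K)"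
  by (auto simp: involution_on_def mem_solutions_iff algebra_simps)

lemma vieta_jump:
  assumes "(M, N) \<in> solutions K"
  shows "N * ((K - 2) * M - N) = M * M - 1"
  using assms by (simp add: mem_solutions_iff algebra_simps)

lemma vieta_jump_bounds:
  assumes "(M, N) \<in> solutions K" "0 < M" "M \<le> N"
  shows "0 \<le> (K - 2) * M - N" "(K - 2) * M - N < M"
proof -
  let ?N' = "(K - 2) * M - N"
  note jump = vieta_jump[OF assms(1)]
  \<comment> \<open>Integrality matters here: a positive \<open>M * M\<close> is at least 1, so the
    product of the two roots is nonnegative.\<close>
  have "0 < M * M" using assms(2) by simp
  hence "0 \<le> N * ?N'" unfolding jump by linarith
  thus "0 \<le> ?N'" using assms(2,3) by (simp add: zero_le_mult_iff)
  have "M * M \<le> N * M" using assms(2,3) by (simp add: mult_right_mono)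
  hence "N * ?N' < N * M" using jump by linarith
  thus "?N' < M" using assms(2,3) by (simp add: mult_less_cancel_left)
qed

text \<open>Strong induction on the smaller entry. Evenness of \<open>n\<close> is carried along
  because it fixes which map comes next: \<open>iota0\<close>, then \<open>iota1\<close>.\<close>

lemma ordered_solution_in_orbit:
  assumes "(M, N) \<in> solutions K" "0 \<le> M" "M \<le> N"
  shows "\<exists>n. even n \<and> orbit K n = (M, N)"
  using assms
proof (induction "nat M" arbitrary: M N rule: less_induct)
  case less
  show ?case
  proof (cases "M = 0")
    case True
    hence "N * N = 1" using less.prems(1) by (simp add: mem_solutions_iff)
    \<comment> \<open>The other root, -1, is excluded by \<open>M \<le> N\<close>.\<close>
    hence "N = 1" using less.prems(2,3) by (simp add: zmult_eq_1_iff True)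
    thus ?thesis using True by (intro exI[of _ 0]) simp
  next
    case False
    hence "0 < M" using less.prems(2) by simp
    define N' where "N' = (K - 2) * M - N"
    have bounds: "0 \<le> N'" "N' < M"
      using vieta_jump_bounds[OF less.prems(1) \<open>0 < M\<close> less.prems(3)] by (simp_all add: N'_def)
    have "(N', M) \<in> solutions K"
      using less.prems(1) by (simp add: N'_def mem_solutions_iff algebra_simps)
    then obtain n where "even n" "orbit K n = (N', M)"
      using less.hyps[of N' M] bounds by auto
    \<comment> \<open>The two steps send \<open>(N', M)\<close> to \<open>(M, N')\<close> and then
      to \<open>(M, (K - 2) * M - N')\<close>, whose second entry is \<open>N\<close>.\<close>
    hence "even (Suc (Suc n))" "orbit K (Suc (Suc n)) = (M, N)"
      by (simp_all add: N'_def)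
    thus ?thesis by blast
  qed
qed

lemma nonneg_solution_in_orbit:
  assumes "p \<in> nonneg_solutions K"
  shows "\<exists>n. orbit K n = p"
proof -
  obtain M N where p: "p = (M, N)" by (cases p)
  have sol: "(M, N) \<in> solutions K" "0 \<le> M" "0 \<le> N"
    using assms by (auto simp: p nonneg_solutions_def)
  show ?thesis
  proof (cases "M \<le> N")
    case True
    thus ?thesis using ordered_solution_in_orbit[OF sol(1,2)] p by blast
  next
    case False
    have "(N, M) \<in> solutions K"
      using sol(1) by (simp add: mem_solutions_iff algebra_simps)
    then obtain n where "even n" "orbit K n = (N, M)"
      using ordered_solution_in_orbit[of N M K] sol(3) False by auto
    \<comment> \<open>As \<open>n\<close> is even, the next map is \<open>iota0\<close>, which
      restores the original order.\<close>
    hence "orbit K (Suc n) = p" by (simp add: p)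
    thus ?thesis ..
  qed
qed

theorem theorem1p2:
  fixes K :: int
  assumes "K \<ge> 3"
  shows "involution_on (solutions K) iota0
    \<and> involution_on (solutions K) (iota1 K)
    \<and> involution_on (solutions K) (iota2 K)
    \<and> iota2 K = iota0 \<circ> iota1 K \<circ> iota0
    \<and> (0, 1) \<in> solutions K
    \<and> (\<forall>p \<in> nonneg_solutions K. \<exists>n. orbit K n = p)
    \<and> orbit K 1 = (1, 0)
    \<and> orbit K 2 = (1, K - 2)
    \<and> orbit K 3 = (K - 2, 1)
    \<and> orbit K 4 = (K - 2, (K - 2)^2 - 1)"
proof (intro conjI ballI)
  show "(0, 1) \<in> solutions K" by (simp add: mem_solutions_iff)
  have steps: "orbit K 1 = (1, 0)" "orbit K 2 = (1, K - 2)" "orbit K 3 = (K - 2, 1)"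
    by (simp_all add: numeral_2_eq_2 numeral_3_eq_3)
  thus "orbit K 1 = (1, 0)" "orbit K 2 = (1, K - 2)" "orbit K 3 = (K - 2, 1)" .
  \<comment> \<open>The successor form exposes the recursion; index 3 is odd, so
    \<open>iota1\<close> applies.\<close>
  have "orbit K 4 = orbit K (Suc 3)" by simp
  also have "\<dots> = iota1 K (orbit K 3)" by (subst orbit.simps) simp
  finally show "orbit K 4 = (K - 2, (K - 2)^2 - 1)"
    unfolding steps by (simp add: power2_eq_square)
qed (fact involution_on_iota0 involution_on_iota1 involution_on_iota2 iota2_eq_conj
  | erule nonneg_solution_in_orbit)+

end
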